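(* Let a finite extensive-form game with history set $H$ and terminal histories $Z\subseteq H$, a strategy profile $\sigma$, and a value function $v: Z\to\mathbb{R}$ be given. Let $z_1,\dots,z_T\in Z$ be any given set of trials (terminal histories reached with positive probability under $\sigma$). Parameterize the heuristic value function by $\bm{\theta}\in\mathbb{R}^H$ via $v'_{\bm{\theta}}(h)=\theta_h$ for $h\in H$, and let $\hat v_{\bm{\theta}}(z)=b(z)+\langle \mathbf{c}(z),\bm{\theta}\rangle$ be the resulting AIVAT estimate, where $b(z)\in\mathbb{R}$ and $\mathbf{c}(z)\in\mathbb{R}^H$ do not depend on $\bm{\theta}$. Then there exists $\bm{\theta}^*\in\mathbb{R}^H$ that achieves the lowest possible sample variance of the estimates $\hat v_{\bm{\theta}}(z_1),\dots,\hat v_{\bm{\theta}}(z_T)$; that is, $\bm{\theta}^*$ attains the minimum over $\bm{\theta}\in\mathbb{R}^H$ of $$C(\bm{\theta})=\sum_{t=1}^T\Big(\hat v_{\bm{\theta}}(z_t)-\frac1T\sum_{t'=1}^T\hat v_{\bm{\theta}}(z_{t'})\Big)^2 .$$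
   Context: An extensive-form game has a finite set of players (including chance $p_c$) and a finite set of histories $H$. Each non-terminal history $h$ has an acting player $p(h)$ and a set of available actions $A(h)$; $h\cdot a$ is the history obtained by applying $a\in A(h)$ at $h$. $Z\subseteq H$ is the set of terminal histories. For a strategy profile $\sigma$ (together with the fixed chance probabilities), $\pi(h)$ is the probability of reaching $h$. $U(h)$ is the set of histories differing from $h$ only by the private information belonging to $p(h)$ (and $h\in U(h)$); $A(U(h))$ is the common set of actions available at the histories in $U(h)$. $K(z)$ is the set of histories $h\cdot a$ on the path to $z$ for which the probability distribution over actions at the immediate parent $h$ is known. Given a heuristic value function $v':H\to\mathbb{R}$, the AIVAT estimate at $z\in Z$ is $\hat v(z)=\hat v_b(z)+\hat v_c(z)$, where $$\hat v_b(z)=\frac{\sum_{z'\in U(z)}\pi(z')v(z')}{\sum_{z'\in U(z)}\pi(z')},$$ $$\hat v_c(z)=\sum_{h\cdot a\in K(z)}\left(\frac{\sum_{a'\in A(U(h))}\sum_{h'\in U(h)}\pi(h'\cdot a')v'(h'\cdot a')}{\sum_{h'\in U(h)}\pi(h')}-\frac{\sum_{h'\in U(h)}\pi(h'\cdot a)v'(h'\cdot a)}{\sum_{h'\in U(h)}\pi(h'\cdot a)}\right).$$ This is an affine function of the heuristic outputs: $\hat v(z)=b(z)+\sum_{h\in H}\mathbf{c}(z)_h\,v'(h)$, where $b(z)=\hat v_b(z)$ and $\mathbf{c}(z)_h$ is the total coefficient of $v'(h)$ in $\hat v_c(z)$. The sample variance of the estimates is $C(\bm{\theta})$ up to a positive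 constant factor independent of $\bm{\theta}$. *)

theory Defs
  imports "HOL-Probability.Probability" "HOL-Library.Sublist"
begin

text \<open>
  A history is the sequence of actions taken so far, so the history written \<open>h\<cdot>a\<close> in the
  literature is \<open>h @ [a]\<close>.  The value of \<open>player\<close> at a terminal history, where nobody
  acts, is the player whose private information is averaged out in the base value.  The field
  \<open>hide i h\<close> is what remains of \<open>h\<close> after deleting the private information of player \<open>i\<close>;
  its values are only ever compared for equality.
\<close>

record ('a, 'p, 'o) game =
  players :: "'p set"
  chance_player :: 'p
  histories :: "'a list set"
  player :: "'a list \<Rightarrow> 'p"
  chance :: "'a list \<Rightarrow> 'a pmf"
  hide :: "'p \<Rightarrow> 'a list \<Rightarrow> 'o"

definition actions :: "('a, 'p, 'o) game \<Rightarrow> 'a list \<Rightarrow> 'a set" where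
  "actions G h = {a. h @ [a] \<in> histories G}"

definition terminals :: "('a, 'p, 'o) game \<Rightarrow> 'a list set" where
  "terminals G = {h \<in> histories G. actions G h = {}}"

text \<open>The class \<open>U(h)\<close> of a history.\<close>

definition private_class :: "('a, 'p, 'o) game \<Rightarrow> 'a list \<Rightarrow> 'a list set" where
  "private_class G h =
     {h' \<in> histories G. hide G (player G h) h' = hide G (player G h) h}"

text \<open>
  The last condition says that \<open>A(U(h))\<close> is well defined; for terminal \<open>h\<close> it makes every
  member of \<open>U(h)\<close> terminal.
\<close>

definition extensive_form_game :: "('a, 'p, 'o) game \<Rightarrow> bool" where
  "extensive_form_game G \<longleftrightarrow>
     finite (players G) \<and> chance_player G \<in> players G \<and>
     finite (histories G) \<and> [] \<in> histories G \<and>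
     (\<forall>h a. h @ [a] \<in> histories G \<longrightarrow> h \<in> histories G) \<and>
     (\<forall>h\<in>histories G. player G h \<in> players G) \<and>
     (\<forall>h\<in>histories G - terminals G. player G h = chance_player G \<longrightarrow>
        set_pmf (chance G h) \<subseteq> actions G h) \<and>
     (\<forall>h\<in>histories G. \<forall>h'\<in>private_class G h. actions G h' = actions G h)"

definition common_actions :: "('a, 'p, 'o) game \<Rightarrow> 'a list set \<Rightarrow> 'a set" where
  "common_actions G S = (\<Inter>h\<in>S. actions G h)"

definition strategy_profile ::
    "('a, 'p, 'o) game \<Rightarrow> ('p \<Rightarrow> 'a list \<Rightarrow> 'a pmf) \<Rightarrow> bool" where
  "strategy_profile G \<sigma> \<longleftrightarrow>
     (\<forall>h\<in>histories G - terminals G. player G h \<noteq> chance_player G \<longrightarrow>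
        set_pmf (\<sigma> (player G h) h) \<subseteq> actions G h)"

definition action_dist ::
    "('a, 'p, 'o) game \<Rightarrow> ('p \<Rightarrow> 'a list \<Rightarrow> 'a pmf) \<Rightarrow> 'a list \<Rightarrow> 'a pmf" where
  "action_dist G \<sigma> h =
     (if player G h = chance_player G then chance G h else \<sigma> (player G h) h)"

text \<open>The reach probability \<open>\<pi>(h)\<close>.\<close>

definition reach ::
    "('a, 'p, 'o) game \<Rightarrow> ('p \<Rightarrow> 'a list \<Rightarrow> 'a pmf) \<Rightarrow> 'a list \<Rightarrow> real" where
  "reach G \<sigma> h = (\<Prod>i<length h. pmf (action_dist G \<sigma> (take i h)) (h ! i))"

text \<open>
  The set \<open>K(z)\<close>, where \<open>N\<close> is the set of non-terminal histories at which the distribution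
  over actions is known.
\<close>

definition known_path :: "'a list set \<Rightarrow> 'a list \<Rightarrow> 'a list set" where
  "known_path N z = {h @ [a] | h a. h \<in> N \<and> prefix (h @ [a]) z}"

definition base_value ::
    "('a, 'p, 'o) game \<Rightarrow> ('p \<Rightarrow> 'a list \<Rightarrow> 'a pmf) \<Rightarrow> ('a list \<Rightarrow> real) \<Rightarrow> 'a list \<Rightarrow> real"
  where
  "base_value G \<sigma> v z =
     (\<Sum>z'\<in>private_class G z. reach G \<sigma> z' * v z') / (\<Sum>z'\<in>private_class G z. reach G \<sigma> z')"

text \<open>An element \<open>g = h\<cdot>a\<close> of \<open>K(z)\<close> is taken apart as \<open>h = butlast g\<close>, \<open>a = last g\<close>.\<close>

definition correction ::
    "('a, 'p, 'o) game \<Rightarrow> ('p \<Rightarrow> 'a list \<Rightarrow> 'a pmf) \<Rightarrow> 'a list set \<Rightarrow>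
     ('a list \<Rightarrow> real) \<Rightarrow> 'a list \<Rightarrow> real" where
  "correction G \<sigma> N v' z =
     (\<Sum>g\<in>known_path N z.
        let U = private_class G (butlast g); a = last g in
          (\<Sum>a'\<in>common_actions G U. \<Sum>h'\<in>U. reach G \<sigma> (h' @ [a']) * v' (h' @ [a']))
            / (\<Sum>h'\<in>U. reach G \<sigma> h')
        - (\<Sum>h'\<in>U. reach G \<sigma> (h' @ [a]) * v' (h' @ [a]))
            / (\<Sum>h'\<in>U. reach G \<sigma> (h' @ [a])))"

definition aivat ::
    "('a, 'p, 'o) game \<Rightarrow> ('p \<Rightarrow> 'a list \<Rightarrow> 'a pmf) \<Rightarrow> ('a list \<Rightarrow> real) \<Rightarrow> 'a list set \<Rightarrow>
     ('a list \<Rightarrow> real) \<Rightarrow> 'a list \<Rightarrow> real" where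
  "aivat G \<sigma> v N v' z = base_value G \<sigma> v z + correction G \<sigma> N v' z"

text \<open>The total coefficient of \<open>v'(k)\<close> in \<open>correction G \<sigma> N v' z\<close>.\<close>

definition coefficient ::
    "('a, 'p, 'o) game \<Rightarrow> ('p \<Rightarrow> 'a list \<Rightarrow> 'a pmf) \<Rightarrow> 'a list set \<Rightarrow>
     'a list \<Rightarrow> 'a list \<Rightarrow> real" where
  "coefficient G \<sigma> N z k =
     (\<Sum>g\<in>known_path N z.
        let U = private_class G (butlast g); a = last g in
          (\<Sum>a'\<in>common_actions G U. \<Sum>h'\<in>U. if h' @ [a'] = k then reach G \<sigma> (h' @ [a']) else 0)
            / (\<Sum>h'\<in>U. reach G \<sigma> h')
        - (\<Sum>h'\<in>U. if h' @ [a] = k then reach G \<sigma> (h' @ [a]) else 0)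
            / (\<Sum>h'\<in>U. reach G \<sigma> (h' @ [a])))"

definition sum_sq_dev :: "nat \<Rightarrow> (nat \<Rightarrow> real) \<Rightarrow> real" where
  "sum_sq_dev T x = (\<Sum>t=1..T. (x t - (1 / real T) * (\<Sum>t'=1..T. x t'))\<^sup>2)"

end

theory Submission
  imports Defs
begin

text \<open>
  The estimate is affine in the heuristic values, so \<open>C(\<theta>)\<close> is a linear least-squares objective
  in finitely many unknowns.  Minimizers exist by induction on the number of unknowns: projecting
  the data and the remaining columns onto the orthogonal complement of one column eliminates its
  unknown, whose optimal value is recovered afterwards.
\<close>

text \<open>The subtracted multiple of \<open>m\<close> is the orthogonal projection of
  \<open>r\<close> onto \<open>m\<close>. If \<open>m\<close> vanishes on \<open>A\<close>, the
  quotient is 0 by the convention for division by zero, and every summand is 0 anyway.\<close>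

lemma residual_orthogonal:
  fixes r m :: "'t \<Rightarrow> real"
  assumes "finite A"
  shows "(\<Sum>t\<in>A. (r t - (\<Sum>i\<in>A. r i * m i) / (\<Sum>i\<in>A. (m i)\<^sup>2) * m t) * m t) = 0"
proof (cases "(\<Sum>i\<in>A. (m i)\<^sup>2) = 0")
  case True
  then have "\<forall>i\<in>A. m i = 0"
    using assms by (simp add: sum_nonneg_eq_0_iff)
  then show ?thesis by simp
next
  case False
  define c where "c = (\<Sum>i\<in>A. r i * m i) / (\<Sum>i\<in>A. (m i)\<^sup>2)"
  have "(\<Sum>t\<in>A. (r t - c * m t) * m t) = (\<Sum>t\<in>A. r t * m t) - c * (\<Sum>t\<in>A. (m t)\<^sup>2)"
    by (simp add: algebra_simps power2_eq_square sum_subtractf sum_distrib_left)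
  also have "\<dots> = 0"
    using False by (simp add: c_def)
  finally show ?thesis by (simp add: c_def)
qed

text \<open>Pythagoras for \<open>r + x * m = (r - c * m) + (x + c) * m\<close>, whose two parts are
  orthogonal. All dependence on \<open>x\<close> ends up in one square, which vanishes at
  \<open>x = - c\<close>.\<close>

lemma sum_power2_add_scaled:
  fixes r m :: "'t \<Rightarrow> real"
  assumes "finite A"
  defines "c \<equiv> (\<Sum>i\<in>A. r i * m i) / (\<Sum>i\<in>A. (m i)\<^sup>2)"
  shows "(\<Sum>t\<in>A. (r t + x * m t)\<^sup>2) =
    (\<Sum>t\<in>A. (r t - c * m t)\<^sup>2) + (x + c)\<^sup>2 * (\<Sum>t\<in>A. (m t)\<^sup>2)"
proof -
  have "(\<Sum>t\<in>A. (r t + x * m t)\<^sup>2) =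
      (\<Sum>t\<in>A. (r t - c * m t)\<^sup>2 + 2 * (x + c) * ((r t - c * m t) * m t) + (x + c)\<^sup>2 * (m t)\<^sup>2)"
    by (rule sum.cong) (auto simp: power2_eq_square algebra_simps)
  also have "\<dots> = (\<Sum>t\<in>A. (r t - c * m t)\<^sup>2)
      + 2 * (x + c) * (\<Sum>t\<in>A. (r t - c * m t) * m t) + (x + c)\<^sup>2 * (\<Sum>t\<in>A. (m t)\<^sup>2)"
    by (simp only: sum.distrib sum_distrib_left)
  finally show ?thesis
    using residual_orthogonal[OF assms(1), of r m] by (simp add: c_def)
qed

lemma least_squares_minimizer_exists:
  fixes M :: "'t \<Rightarrow> 'k \<Rightarrow> real" and d :: "'t \<Rightarrow> real"
  assumes "finite K" and "finite A"
  shows "\<exists>\<theta>\<^sub>0. \<forall>\<theta>. (\<Sum>t\<in>A. (d t + (\<Sum>h\<in>K. M t h * \<theta>\<^sub>0 h))\<^sup>2)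
                 \<le> (\<Sum>t\<in>A. (d t + (\<Sum>h\<in>K. M t h * \<theta> h))\<^sup>2)"
  using assms(1)
\<comment> \<open>\<open>d\<close> and \<open>M\<close> are generalized because the induction
  hypothesis is applied to the projected data \<open>d'\<close> and \<open>M'\<close>.\<close>
proof (induction K arbitrary: d M rule: finite_induct)
  case empty
  then show ?case by simp
next
  case (insert k K)
  define s where "s = (\<Sum>t\<in>A. (M t k)\<^sup>2)"
  \<comment> \<open>This is the coefficient of the projection onto column \<open>k\<close>. If that
    column vanishes on \<open>A\<close>, then \<open>s = 0\<close> and \<open>proj\<close> is
    identically 0, so this degenerate case needs no separate treatment.\<close>
  define proj where "proj r = (\<Sum>t\<in>A. r t * M t k) / s" for r
  define d' where "d' t = d t - proj d * M t k" for t
  define M' where "M' t h = M t h - proj (\<lambda>i. M i h) * M t k" for t h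
  define res where "res \<theta> t = d t + (\<Sum>h\<in>K. M t h * \<theta> h)" for \<theta> t
  define Q where "Q \<theta> = (\<Sum>t\<in>A. (d' t + (\<Sum>h\<in>K. M' t h * \<theta> h))\<^sup>2)" for \<theta>
  have proj_res: "proj (res \<theta>) = proj d + (\<Sum>h\<in>K. proj (\<lambda>i. M i h) * \<theta> h)" for \<theta>
  proof -
    have "(\<Sum>t\<in>A. res \<theta> t * M t k) =
        (\<Sum>t\<in>A. d t * M t k) + (\<Sum>t\<in>A. \<Sum>h\<in>K. M t h * M t k * \<theta> h)"
      by (simp add: res_def algebra_simps sum.distrib sum_distrib_left)
    also have "(\<Sum>t\<in>A. \<Sum>h\<in>K. M t h * M t k * \<theta> h) = (\<Sum>h\<in>K. (\<Sum>t\<in>A. M t h * M t k) * \<theta> h)"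
      by (subst sum.swap) (simp add: sum_distrib_right)
    finally show ?thesis
      by (simp add: proj_def add_divide_distrib sum_divide_distrib[where A = K])
  qed
  \<comment> \<open>By linearity of \<open>proj\<close>, projecting the data and columns separately
    amounts to projecting the combined residual \<open>res \<theta>\<close>.\<close>
  have reduced: "d' t + (\<Sum>h\<in>K. M' t h * \<theta> h) = res \<theta> t - proj (res \<theta>) * M t k" for \<theta> t
    by (simp add: proj_res d'_def M'_def res_def algebra_simps sum_subtractf sum_distrib_left)
  have split: "(\<Sum>t\<in>A. (d t + (\<Sum>h\<in>insert k K. M t h * \<theta> h))\<^sup>2) =
      Q \<theta> + (\<theta> k + proj (res \<theta>))\<^sup>2 * s" for \<theta>
  proof -
    have "(\<Sum>t\<in>A. (d t + (\<Sum>h\<in>insert k K. M t h * \<theta> h))\<^sup>2) =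
        (\<Sum>t\<in>A. (res \<theta> t + \<theta> k * M t k)\<^sup>2)"
      using insert.hyps by (simp add: res_def algebra_simps)
    then show ?thesis
      using sum_power2_add_scaled[OF assms(2), of "res \<theta>" "\<theta> k" "\<lambda>t. M t k"]
      by (simp add: Q_def reduced proj_def s_def)
  qed
  obtain \<theta>\<^sub>1 where min: "Q \<theta>\<^sub>1 \<le> Q \<theta>" for \<theta>
    using insert.IH[of d' M'] by (auto simp: Q_def)
  \<comment> \<open>This value of the eliminated unknown makes the square in \<open>split\<close>
    zero. Since \<open>k\<close> is not in \<open>K\<close>, the update affects neither
    \<open>res\<close> nor \<open>Q\<close>.\<close>
  define \<theta>\<^sub>0 where "\<theta>\<^sub>0 = \<theta>\<^sub>1(k := - proj (res \<theta>\<^sub>1))"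
  have agree: "(\<Sum>h\<in>K. f h * \<theta>\<^sub>0 h) = (\<Sum>h\<in>K. f h * \<theta>\<^sub>1 h)" for f :: "'k \<Rightarrow> real"
    using insert.hyps by (intro sum.cong) (auto simp: \<theta>\<^sub>0_def)
  have "res \<theta>\<^sub>0 = res \<theta>\<^sub>1" and "Q \<theta>\<^sub>0 = Q \<theta>\<^sub>1"
    by (auto simp: res_def Q_def agree)
  moreover have "\<theta>\<^sub>0 k = - proj (res \<theta>\<^sub>1)"
    by (simp add: \<theta>\<^sub>0_def)
  ultimately have "(\<Sum>t\<in>A. (d t + (\<Sum>h\<in>insert k K. M t h * \<theta>\<^sub>0 h))\<^sup>2) = Q \<theta>\<^sub>1"
    unfolding split by simp
  also have "\<dots> \<le> (\<Sum>t\<in>A. (d t + (\<Sum>h\<in>insert k K. M t h * \<theta> h))\<^sup>2)" for \<theta>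
    unfolding split using min[of \<theta>] by (simp add: s_def sum_nonneg add_increasing2)
  finally show ?case by blast
qed

text \<open>Taking the mean is linear, so the deviations from it are again affine in \<theta>, with
  centred constants and centred columns. The objective is therefore a least-squares sum.\<close>

lemma sum_sq_dev_affine_minimizer_exists:
  fixes c :: "nat \<Rightarrow> 'k \<Rightarrow> real"
  assumes "finite K"
  shows "\<exists>\<theta>\<^sub>0. \<forall>\<theta>. sum_sq_dev T (\<lambda>t. b t + (\<Sum>h\<in>K. c t h * \<theta>\<^sub>0 h))
                 \<le> sum_sq_dev T (\<lambda>t. b t + (\<Sum>h\<in>K. c t h * \<theta> h))"
proof -
  define mean where "mean x = (1 / real T) * (\<Sum>t=1..T. x t)" for x
  have mean: "mean (\<lambda>t. b t + (\<Sum>h\<in>K. c t h * \<theta> h)) =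
      mean b + (\<Sum>h\<in>K. mean (\<lambda>t. c t h) * \<theta> h)" for \<theta>
  proof -
    have "(\<Sum>t=1..T. \<Sum>h\<in>K. c t h * \<theta> h) = (\<Sum>h\<in>K. (\<Sum>t=1..T. c t h) * \<theta> h)"
      by (subst sum.swap) (simp add: sum_distrib_right)
    then show ?thesis
      by (simp add: mean_def sum.distrib add_divide_distrib sum_divide_distrib[where A = K])
  qed
  have "sum_sq_dev T (\<lambda>t. b t + (\<Sum>h\<in>K. c t h * \<theta> h)) =
      (\<Sum>t=1..T. (b t - mean b + (\<Sum>h\<in>K. (c t h - mean (\<lambda>t. c t h)) * \<theta> h))\<^sup>2)" for \<theta>
    unfolding sum_sq_dev_def mean_def[symmetric] mean
    by (simp add: algebra_simps sum_subtractf)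
  then show ?thesis
    using least_squares_minimizer_exists[OF assms, of "{1..T}"] by simp
qed

text \<open>The definition of a game allows dropping one final action at a time; reverse induction
  on the removed suffix iterates this.\<close>

lemma history_prefix_closed:
  assumes "extensive_form_game G" and "y \<in> histories G" and "prefix h y"
  shows "h \<in> histories G"
proof -
  have "h @ xs \<in> histories G \<Longrightarrow> h \<in> histories G" for xs
  proof (induction xs rule: rev_induct)
    case (snoc a xs)
    then show ?case
      using assms(1) unfolding extensive_form_game_def append_assoc[symmetric] by blast
  qed simp
  then show ?thesis
    using assms(2,3) by (auto simp: prefix_def)
qed

text \<open>After exchanging the sums, each \<open>x\<close> contributes only at
  \<open>k = f x\<close>, and this index lies in \<open>H\<close>. With \<open>f\<close> mapping to
  child histories, this turns total coefficients back into weighted sums of heuristic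
  values.\<close>

lemma sum_indicator_coefficient:
  fixes \<theta> :: "'k \<Rightarrow> real"
  assumes "finite H" and "\<And>x. x \<in> S \<Longrightarrow> f x \<in> H"
  shows "(\<Sum>k\<in>H. (\<Sum>x\<in>S. if f x = k then r x else 0) * \<theta> k) = (\<Sum>x\<in>S. r x * \<theta> (f x))"
proof -
  have "(\<Sum>k\<in>H. (\<Sum>x\<in>S. if f x = k then r x else 0) * \<theta> k) =
      (\<Sum>x\<in>S. \<Sum>k\<in>H. if f x = k then r x * \<theta> k else 0)"
    by (subst sum.swap) (auto simp: sum_distrib_right intro!: sum.cong)
  also have "\<dots> = (\<Sum>x\<in>S. r x * \<theta> (f x))"
    using assms by (intro sum.cong) auto
  finally show ?thesis .
qed

text \<open>Each term of the correction is a difference of two linear forms in \<theta>, with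
  coefficients \<open>p\<close> and \<open>q\<close>. Only children that are histories occur in
  them, so summing over all histories captures every coefficient. The denominators agree on both
  sides, including where they vanish and the quotients are 0.\<close>

lemma correction_eq_sum_coefficient:
  assumes game: "extensive_form_game G" and N: "N \<subseteq> histories G" and y: "y \<in> histories G"
  shows "correction G \<sigma> N \<theta> y = (\<Sum>k\<in>histories G. coefficient G \<sigma> N y k * \<theta> k)"
proof -
  let ?H = "histories G"
  have fin: "finite ?H"
    using game by (simp add: extensive_form_game_def)
  have same_actions: "actions G h' = actions G h" if "h \<in> ?H" "h' \<in> private_class G h" for h h'
    using game that by (simp add: extensive_form_game_def)
  define U where "U g = private_class G (butlast g)" for g
  define A where "A g = common_actions G (U g)" for g
  define p where "p g k = (\<Sum>a'\<in>A g. \<Sum>h'\<in>U g.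
    if h' @ [a'] = k then reach G \<sigma> (h' @ [a']) else 0) / (\<Sum>h'\<in>U g. reach G \<sigma> h')" for g k
  define q where "q g k = (\<Sum>h'\<in>U g.
    if h' @ [last g] = k then reach G \<sigma> (h' @ [last g]) else 0)
      / (\<Sum>h'\<in>U g. reach G \<sigma> (h' @ [last g]))" for g k
  have child: "h' @ [a] \<in> ?H" if "a \<in> A g" "h' \<in> U g" for g a h'
    using that by (auto simp: A_def common_actions_def actions_def)
  \<comment> \<open>The action leading to \<open>g\<close> is available at the parent of
    \<open>g\<close>, as \<open>g\<close> is a prefix of the history \<open>y\<close>; the members
    of a private class share their actions, so it is available at \<open>h'\<close> too.\<close>
  have taken: "h' @ [last g] \<in> ?H" if "g \<in> known_path N y" "h' \<in> U g" for g h'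
  proof -
    from that(1) obtain h a where g: "g = h @ [a]" "h \<in> N" "prefix g y"
      by (auto simp: known_path_def)
    then have "a \<in> actions G h"
      using history_prefix_closed[OF game y] by (simp add: actions_def)
    then have "a \<in> actions G h'"
      using same_actions[of h h'] g N that(2) by (auto simp: U_def)
    then show ?thesis by (simp add: g actions_def)
  qed
  have p_sum: "(\<Sum>k\<in>?H. p g k * \<theta> k) =
      (\<Sum>a'\<in>A g. \<Sum>h'\<in>U g. reach G \<sigma> (h' @ [a']) * \<theta> (h' @ [a'])) / (\<Sum>h'\<in>U g. reach G \<sigma> h')"
    for g
  proof -
    \<comment> \<open>The double sum over actions and class members is indexed by pairs, so that it
      becomes a single sum of the form handled by \<open>sum_indicator_coefficient\<close>.\<close>
    have "(\<Sum>k\<in>?H. (\<Sum>x\<in>A g \<times> U g.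
          if snd x @ [fst x] = k then reach G \<sigma> (snd x @ [fst x]) else 0) * \<theta> k) =
        (\<Sum>x\<in>A g \<times> U g. reach G \<sigma> (snd x @ [fst x]) * \<theta> (snd x @ [fst x]))"
      using fin child by (intro sum_indicator_coefficient) auto
    then show ?thesis
      by (simp add: p_def sum.cartesian_product case_prod_unfold flip: sum_divide_distrib)
  qed
  have q_sum: "(\<Sum>k\<in>?H. q g k * \<theta> k) =
      (\<Sum>h'\<in>U g. reach G \<sigma> (h' @ [last g]) * \<theta> (h' @ [last g]))
        / (\<Sum>h'\<in>U g. reach G \<sigma> (h' @ [last g]))" if "g \<in> known_path N y" for g
    using sum_indicator_coefficient[OF fin, of "U g" "\<lambda>h'. h' @ [last g]"] taken[OF that]
    by (simp add: q_def flip: sum_divide_distrib)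
  have "(\<Sum>k\<in>?H. coefficient G \<sigma> N y k * \<theta> k) =
      (\<Sum>k\<in>?H. \<Sum>g\<in>known_path N y. p g k * \<theta> k - q g k * \<theta> k)"
    by (simp add: coefficient_def Let_def p_def q_def A_def U_def sum_distrib_right
        left_diff_distrib)
  also have "\<dots> = (\<Sum>g\<in>known_path N y. (\<Sum>k\<in>?H. p g k * \<theta> k) - (\<Sum>k\<in>?H. q g k * \<theta> k))"
    by (subst sum.swap) (simp add: sum_subtractf)
  also have "\<dots> = correction G \<sigma> N \<theta> y"
    unfolding correction_def Let_def
    by (intro sum.cong refl) (simp add: p_sum q_sum, simp add: A_def U_def)
  finally show ?thesis by simp
qed

text \<open>Vectors in the parameter space are represented by extensional functions, hence the set
  \<open>histories G \<rightarrow>\<^sub>E UNIV\<close>. The first conjunct confirms that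
  \<open>base_value\<close> and \<open>coefficient\<close> give the affine form of the estimate;
  through it the second reduces to least squares.\<close>

theorem proposition1:
  fixes G :: "('a, 'p, 'o) game"
    and \<sigma> :: "'p \<Rightarrow> 'a list \<Rightarrow> 'a pmf"
    and v :: "'a list \<Rightarrow> real"
    and N :: "'a list set"
    and T :: nat
    and z :: "nat \<Rightarrow> 'a list"
  assumes "extensive_form_game G"
    and "strategy_profile G \<sigma>"
    and "N \<subseteq> histories G - terminals G"
    and "T \<ge> 1"
    and "\<And>t. t \<in> {1..T} \<Longrightarrow> z t \<in> terminals G \<and> reach G \<sigma> (z t) > 0"
  shows "(\<forall>y\<in>terminals G. \<forall>\<theta>\<in>histories G \<rightarrow>\<^sub>E UNIV.
            aivat G \<sigma> v N \<theta> y =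
              base_value G \<sigma> v y + (\<Sum>h\<in>histories G. coefficient G \<sigma> N y h * \<theta> h)) \<and>
         (\<exists>\<theta>\<^sub>0\<in>histories G \<rightarrow>\<^sub>E UNIV. \<forall>\<theta>\<in>histories G \<rightarrow>\<^sub>E UNIV.
            sum_sq_dev T (\<lambda>t. aivat G \<sigma> v N \<theta>\<^sub>0 (z t)) \<le>
            sum_sq_dev T (\<lambda>t. aivat G \<sigma> v N \<theta> (z t)))"
proof -
  have fin: "finite (histories G)"
    using assms(1) by (simp add: extensive_form_game_def)
  have affine: "aivat G \<sigma> v N \<theta> y =
      base_value G \<sigma> v y + (\<Sum>h\<in>histories G. coefficient G \<sigma> N y h * \<theta> h)"
    if "y \<in> terminals G" for y \<theta>
    using correction_eq_sum_coefficient[of G N y \<sigma> \<theta>] assms(1,3) that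
    by (auto simp: aivat_def terminals_def)
  obtain \<theta>\<^sub>1 where min: "sum_sq_dev T (\<lambda>t. base_value G \<sigma> v (z t) +
        (\<Sum>h\<in>histories G. coefficient G \<sigma> N (z t) h * \<theta>\<^sub>1 h))
      \<le> sum_sq_dev T (\<lambda>t. base_value G \<sigma> v (z t) +
        (\<Sum>h\<in>histories G. coefficient G \<sigma> N (z t) h * \<theta> h))" for \<theta>
    using sum_sq_dev_affine_minimizer_exists[OF fin, of T "\<lambda>t. base_value G \<sigma> v (z t)"
        "\<lambda>t. coefficient G \<sigma> N (z t)"] by blast
  have objective: "sum_sq_dev T (\<lambda>t. aivat G \<sigma> v N \<theta> (z t)) =
      sum_sq_dev T (\<lambda>t. base_value G \<sigma> v (z t) +
        (\<Sum>h\<in>histories G. coefficient G \<sigma> N (z t) h * \<theta> h))" for \<theta>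
    using assms(5) by (simp add: sum_sq_dev_def affine)
  \<comment> \<open>The affine form reads \<theta> only on histories, so making the minimizer
    extensional by \<open>restrict\<close> leaves the objective unchanged.\<close>
  have "sum_sq_dev T (\<lambda>t. aivat G \<sigma> v N (restrict \<theta>\<^sub>1 (histories G)) (z t))
      \<le> sum_sq_dev T (\<lambda>t. aivat G \<sigma> v N \<theta> (z t))" for \<theta>
    using min[of \<theta>] by (simp add: objective)
  moreover have "restrict \<theta>\<^sub>1 (histories G) \<in> histories G \<rightarrow>\<^sub>E UNIV"
    by simp
  ultimately show ?thesis
    using affine by blast
qed

end
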